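(* Let $W$ be a mean zero, finite variance random variable, and let $W^*$ have the $W$-zero bias distribution. Then with $d$ the Wasserstein distance, and $\mathcal{N}$ a mean zero normal variable with the same variance as $W$, $$d(W,\mathcal{N})\le 2d(W,W^* ).$$
   Context: Zero bias: for a mean zero random variable $W$ with variance $\sigma^2$, a random variable $W^*$ has the $W$-zero bias distribution if $E[Wf(W)]=\sigma^2E[f'(W^* )]$ for all absolutely continuous $f$ for which $E[Wf(W)]$ exists. Wasserstein distance: $d(Y,X)=\sup_{h\in\mathcal{L}}|E(h(Y)-h(X))|$, where $\mathcal{L}=\{h:\mathbb{R}\to\mathbb{R}: |h(y)-h(x)|\le|y-x| \text{ for all } x,y\}$; equivalently $d(Y,X)=\inf E|Y-X|$ over all couplings of $Y$ and $X$ with the given marginals (which is $+\infty$ if exactly one of the two is not integrable). *)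

theory Defs
  imports "HOL-Probability.Probability"
begin

text \<open>Absolute continuity of a function on the real line is understood on every compact interval,
  so that it is equivalent to being an indefinite integral of a locally integrable function.
  The finite families of non-overlapping subintervals are divisions of their union.\<close>

definition absolutely_continuous_fun :: "(real \<Rightarrow> real) \<Rightarrow> bool" where
  "absolutely_continuous_fun f \<longleftrightarrow>
     (\<forall>a b. \<forall>\<epsilon>>0. \<exists>\<delta>>0. \<forall>\<D>.
        \<D> division_of \<Union>\<D> \<and> \<Union>\<D> \<subseteq> {a..b} \<and> (\<Sum>K\<in>\<D>. Sup K - Inf K) < \<delta> \<longrightarrow>
        (\<Sum>K\<in>\<D>. \<bar>f (Sup K) - f (Inf K)\<bar>) < \<epsilon>)"

text \<open>\<open>W'\<close> may live on another probability space than \<open>W\<close>. The test functions are those for which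
  the expectations on both sides exist. Existence of \<open>E[W f(W)]\<close> alone does not guarantee that of
  \<open>E[f'(W')]\<close>: if \<open>W\<close> has unbounded support in the integers, \<open>f\<close> can oscillate between the integers
  so strongly that \<open>f'(W')\<close> is not integrable. At points where \<open>f\<close> is not differentiable,
  \<open>deriv f\<close> is an unspecified real number; these points form a null set, and for nonzero variance
  the zero bias law is absolutely continuous with respect to Lebesgue measure.\<close>

definition zero_bias ::
  "'a measure \<Rightarrow> ('a \<Rightarrow> real) \<Rightarrow> 'b measure \<Rightarrow> ('b \<Rightarrow> real) \<Rightarrow> bool" where
  "zero_bias M W M' W' \<longleftrightarrow>
     (\<forall>f. absolutely_continuous_fun f \<and>
          integrable M (\<lambda>x. W x * f (W x)) \<and> integrable M' (\<lambda>y. deriv f (W' y)) \<longrightarrow>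
          (\<integral>x. W x * f (W x) \<partial>M) = prob_space.variance M W * (\<integral>y. deriv f (W' y) \<partial>M'))"

text \<open>The supremum is over the 1-Lipschitz functions whose expectations exist under both laws.
  Bounded functions are always admitted, so the value is \<open>\<infinity>\<close> if exactly one of the two laws has a
  first moment (truncate \<open>\<bar>x\<bar>\<close> at \<open>n\<close>), in agreement with the infimum of \<open>E\<bar>Y - X\<bar>\<close> over couplings.\<close>

definition wasserstein_dist ::
  "'a measure \<Rightarrow> ('a \<Rightarrow> real) \<Rightarrow> 'b measure \<Rightarrow> ('b \<Rightarrow> real) \<Rightarrow> ennreal" where
  "wasserstein_dist M Y N X =
     (SUP h \<in> {h :: real \<Rightarrow> real. 1-lipschitz_on UNIV h \<and>
                 integrable M (\<lambda>x. h (Y x)) \<and> integrable N (\<lambda>x. h (X x))}.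
        ennreal \<bar>(\<integral>x. h (Y x) \<partial>M) - (\<integral>x. h (X x) \<partial>N)\<bar>)"

text \<open>The normal law parametrised by mean and variance; variance 0 gives the point mass.\<close>

definition normal_law :: "real \<Rightarrow> real \<Rightarrow> real measure" where
  "normal_law m v =
     (if v = 0 then return borel m
      else density lborel (\<lambda>x. ennreal (normal_density m (sqrt v) x)))"

end

theory Submission
  imports Defs "HOL-Real_Asymp.Real_Asymp"
begin

text \<open>The proof is Stein's method. Let \<open>v\<close> be the variance of \<open>W\<close>. If \<open>v = 0\<close>, then \<open>W\<close> and the normal
  variable are both almost surely \<open>0\<close>. If \<open>v > 0\<close>, a 1-Lipschitz test function \<open>h\<close> is turned into a
  solution \<open>f\<close> of Stein's equation \<open>v f'(x) - x f(x) = h(x) - E h(Z)\<close>. Taking expectations at \<open>W\<close> and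
  using the zero bias identity,
  \[ E h(W) - E h(Z) = E [v f'(W) - W f(W)] = v (E f'(W) - E f'(W')). \]
  So everything rests on one estimate: \<open>v f'\<close> is 2-Lipschitz, whence \<open>v f' / 2\<close> is a test
  function for the distance between \<open>W\<close> and \<open>W'\<close> and the factor 2 comes out. By scaling it suffices
  to treat \<open>v = 1\<close> (\<open>normal_stein_equation\<close>).

  For \<open>v = 1\<close> the equation reads \<open>f'(x) = x f(x) + h(x) - E h(Z)\<close>, and \<open>h\<close> is 1-Lipschitz, so it is enough
  that \<open>x f(x)\<close> is 1-Lipschitz, that is, \<open>\<bar>f(x) + x f'(x)\<bar> \<le> 1\<close> (\<open>stein_solution_bounds\<close>). This involves
  no derivative of \<open>h\<close>. Let \<open>\<phi>\<close> be the standard normal density. For fixed \<open>x\<close>, let \<open>A\<close> and \<open>B\<close> be the integrals of \<open>(h(y) - h(x)) \<phi>(y)\<close> over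
  \<open>y \<le> x\<close> and \<open>y > x\<close>, and let \<open>n\<close>, \<open>p\<close> be the normal probabilities of these two half-lines. Then
  \[ (f(x) + x f'(x)) \<phi>(x) = A ((1 + x^2) p - x \<phi>(x)) - B ((1 + x^2) n + x \<phi>(x)). \]
  Both coefficients are nonnegative, since they are the integrals of \<open>(y - x)\<^sup>2 \<phi>(y)\<close> over the two
  half-lines (\<open>mills_above\<close>, \<open>mills_below\<close>). The Lipschitz condition bounds \<open>\<bar>A\<bar>\<close> and \<open>\<bar>B\<bar>\<close> by the integrals
  of \<open>\<bar>y - x\<bar> \<phi>(y)\<close>, which are \<open>x n + \<phi>(x)\<close> and \<open>\<phi>(x) - x p\<close>. Inserting these bounds, all products
  cancel and exactly \<open>\<phi>(x)\<close> remains.\<close>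

section \<open>Lipschitz functions\<close>

lemma lipschitz_on_imp_absolutely_continuous_fun:
  assumes "L-lipschitz_on UNIV f"
  shows "absolutely_continuous_fun f"
  unfolding absolutely_continuous_fun_def
proof (intro allI impI)
  fix a b \<epsilon> :: real assume "\<epsilon> > 0"
  have L: "L \<ge> 0" using assms by (rule lipschitz_on_nonneg)
  show "\<exists>\<delta>>0. \<forall>\<D>. \<D> division_of \<Union>\<D> \<and> \<Union>\<D> \<subseteq> {a..b} \<and> (\<Sum>K\<in>\<D>. Sup K - Inf K) < \<delta> \<longrightarrow>
        (\<Sum>K\<in>\<D>. \<bar>f (Sup K) - f (Inf K)\<bar>) < \<epsilon>"
  proof (intro exI[of _ "\<epsilon> / (L + 1)"] conjI allI impI)
    show "\<epsilon> / (L + 1) > 0" using L \<open>\<epsilon> > 0\<close> by simp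
    fix \<D> :: "real set set"
    assume D: "\<D> division_of \<Union>\<D> \<and> \<Union>\<D> \<subseteq> {a..b} \<and> (\<Sum>K\<in>\<D>. Sup K - Inf K) < \<epsilon> / (L + 1)"
    have ordered: "Inf K \<le> Sup K" if "K \<in> \<D>" for K
    proof -
      from D have "\<D> division_of \<Union>\<D>" by blast
      from division_ofD(3,4)[OF this that] obtain c d where "K = cbox c d" "K \<noteq> {}"
        by blast
      then show ?thesis by auto
    qed
    have "(\<Sum>K\<in>\<D>. \<bar>f (Sup K) - f (Inf K)\<bar>) \<le> (\<Sum>K\<in>\<D>. L * (Sup K - Inf K))"
    proof (rule sum_mono)
      fix K assume "K \<in> \<D>"
      show "\<bar>f (Sup K) - f (Inf K)\<bar> \<le> L * (Sup K - Inf K)"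
        using lipschitz_onD[OF assms, of "Sup K" "Inf K"] ordered[OF \<open>K \<in> \<D>\<close>]
        by (simp add: dist_real_def)
    qed
    also have "\<dots> = L * (\<Sum>K\<in>\<D>. Sup K - Inf K)" by (simp add: sum_distrib_left)
    also have "\<dots> \<le> (L + 1) * (\<Sum>K\<in>\<D>. Sup K - Inf K)"
      using ordered by (intro mult_right_mono sum_nonneg) auto
    also have "\<dots> < \<epsilon>" using D L by (simp add: field_simps)
    finally show "(\<Sum>K\<in>\<D>. \<bar>f (Sup K) - f (Inf K)\<bar>) < \<epsilon>" .
  qed
qed

text \<open>A Lipschitz function grows at most linearly.\<close>

lemma lipschitz_on_integrable_comp:
  fixes h :: "real \<Rightarrow> real"
  assumes "finite_measure M" "integrable M X" "L-lipschitz_on UNIV h"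
  shows "integrable M (\<lambda>x. h (X x))"
proof (rule Bochner_Integration.integrable_bound)
  interpret finite_measure M by fact
  show "integrable M (\<lambda>x. \<bar>h 0\<bar> + L * \<bar>X x\<bar>)" using assms(2) by auto
  have [measurable]: "h \<in> borel_measurable borel"
    using lipschitz_on_continuous_on[OF assms(3)] by (rule borel_measurable_continuous_onI)
  show "(\<lambda>x. h (X x)) \<in> borel_measurable M" using assms(2) by measurable
  show "AE x in M. norm (h (X x)) \<le> norm (\<bar>h 0\<bar> + L * \<bar>X x\<bar>)"
  proof (rule AE_I2)
    fix x
    have "\<bar>h (X x) - h 0\<bar> \<le> L * \<bar>X x\<bar>"
      using lipschitz_onD[OF assms(3), of "X x" 0] by (simp add: dist_real_def)
    then show "norm (h (X x)) \<le> norm (\<bar>h 0\<bar> + L * \<bar>X x\<bar>)"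
      by (simp; linarith)
  qed
qed

section \<open>Gaussian integrals over half-lines\<close>

abbreviation \<phi> :: "real \<Rightarrow> real" where "\<phi> \<equiv> std_normal_density"

definition gauss_mean :: "(real \<Rightarrow> real) \<Rightarrow> real" where
  "gauss_mean g = (\<integral>y. g y * \<phi> y \<partial>lborel)"

definition gauss_below :: "real \<Rightarrow> (real \<Rightarrow> real) \<Rightarrow> real" where
  "gauss_below x g = (LINT y:{..x}|lborel. g y * \<phi> y)"

definition gauss_above :: "real \<Rightarrow> (real \<Rightarrow> real) \<Rightarrow> real" where
  "gauss_above x g = (LINT y:{x<..}|lborel. g y * \<phi> y)"

definition gauss_integrable :: "(real \<Rightarrow> real) \<Rightarrow> bool" where
  "gauss_integrable g \<longleftrightarrow> integrable lborel (\<lambda>y. g y * \<phi> y)"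

lemma gauss_integrable_power: "gauss_integrable (\<lambda>y. y ^ n)"
  using integrable_std_normal_moment[of n] by (simp add: gauss_integrable_def mult.commute)

lemma gauss_integrable_intros [intro, simp]:
  "gauss_integrable (\<lambda>y. c)"
  "gauss_integrable (\<lambda>y. y)"
  "gauss_integrable (\<lambda>y. y\<^sup>2)"
  "gauss_integrable f \<Longrightarrow> gauss_integrable g \<Longrightarrow> gauss_integrable (\<lambda>y. f y + g y)"
  "gauss_integrable f \<Longrightarrow> gauss_integrable g \<Longrightarrow> gauss_integrable (\<lambda>y. f y - g y)"
  "gauss_integrable f \<Longrightarrow> gauss_integrable (\<lambda>y. c * f y)"
  using gauss_integrable_power[of 1] gauss_integrable_power[of 2]
  by (auto simp: gauss_integrable_def algebra_simps)

lemma gauss_integrable_restrict: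
  assumes "gauss_integrable g" "S \<in> sets borel"
  shows "set_integrable lborel S (\<lambda>y. g y * \<phi> y)"
  using assms integrable_mult_indicator[of S lborel "\<lambda>y. g y * \<phi> y"]
  by (simp add: gauss_integrable_def set_integrable_def)

lemma gauss_integrable_lipschitz:
  fixes h :: "real \<Rightarrow> real"
  assumes "L-lipschitz_on UNIV h"
  shows "gauss_integrable h"
proof -
  interpret N: prob_space "density lborel \<phi>"
    by (rule prob_space_normal_density) simp
  have [measurable]: "h \<in> borel_measurable borel"
    using lipschitz_on_continuous_on[OF assms] by (rule borel_measurable_continuous_onI)
  have "integrable (density lborel \<phi>) (\<lambda>y. y)"
    using integrable_std_normal_moment[of 1] by (subst integrable_density) auto
  then have "integrable (density lborel \<phi>) (\<lambda>y. h y)"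
    using assms by (rule lipschitz_on_integrable_comp[OF N.finite_measure_axioms])
  then show ?thesis
    by (subst (asm) integrable_density) (auto simp: gauss_integrable_def mult.commute)
qed

lemma gauss_linear:
  assumes "gauss_integrable f" "gauss_integrable g"
  shows "gauss_below x (\<lambda>y. f y + g y) = gauss_below x f + gauss_below x g"
    "gauss_below x (\<lambda>y. f y - g y) = gauss_below x f - gauss_below x g"
    "gauss_above x (\<lambda>y. f y + g y) = gauss_above x f + gauss_above x g"
    "gauss_above x (\<lambda>y. f y - g y) = gauss_above x f - gauss_above x g"
  using assms[THEN gauss_integrable_restrict, of "{..x}"]
    assms[THEN gauss_integrable_restrict, of "{x<..}"]
  by (simp_all add: gauss_below_def gauss_above_def algebra_simps)

lemma gauss_cmult:
  "gauss_below x (\<lambda>y. c * f y) = c * gauss_below x f"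
  "gauss_above x (\<lambda>y. c * f y) = c * gauss_above x f"
  by (simp_all add: gauss_below_def gauss_above_def mult.assoc)

lemma gauss_const:
  "gauss_below x (\<lambda>y. c) = c * gauss_below x (\<lambda>_. 1)"
  "gauss_above x (\<lambda>y. c) = c * gauss_above x (\<lambda>_. 1)"
  using gauss_cmult[of x c "\<lambda>_. 1"] by simp_all

lemma gauss_below_plus_above:
  assumes "gauss_integrable g"
  shows "gauss_below x g + gauss_above x g = gauss_mean g"
proof -
  have "{..x} \<union> {x<..} = UNIV" "{..x} \<inter> {x<..} = {}" by auto
  then show ?thesis
    using set_integral_Un[of "{..x}" "{x<..}" lborel "\<lambda>y. g y * \<phi> y"]
      gauss_integrable_restrict[OF assms]
    by (simp add: gauss_below_def gauss_above_def gauss_mean_def set_lebesgue_integral_def)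
qed

lemma gauss_mono:
  assumes "gauss_integrable f" "gauss_integrable g"
  shows "(\<And>y. y \<le> x \<Longrightarrow> f y \<le> g y) \<Longrightarrow> gauss_below x f \<le> gauss_below x g"
    and "(\<And>y. y > x \<Longrightarrow> f y \<le> g y) \<Longrightarrow> gauss_above x f \<le> gauss_above x g"
  unfolding gauss_below_def gauss_above_def
  using assms by (auto intro!: set_integral_mono gauss_integrable_restrict mult_right_mono)

lemma gauss_moments:
  "gauss_mean (\<lambda>_. 1) = 1" "gauss_mean (\<lambda>y. y) = 0" "gauss_mean (\<lambda>y. y\<^sup>2) = 1"
  using integral_std_normal_moment_even[of 0] integral_std_normal_moment_odd[of 0]
    integral_std_normal_moment_even[of 1]
  by (simp_all add: gauss_mean_def mult.commute fact_numeral)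

lemma phi_eq: "\<phi> = (\<lambda>y. (1 / sqrt (2 * pi)) * exp (- y\<^sup>2 / 2))"
  by (simp add: std_normal_density_def fun_eq_iff)

lemma phi_pos: "\<phi> y > 0"
  by (simp add: normal_density_pos)

lemma phi_deriv: "(\<phi> has_real_derivative - y * \<phi> y) (at y)"
  unfolding phi_eq by (auto intro!: derivative_eq_intros simp: field_simps)

lemma phi_cont: "isCont \<phi> y"
  using phi_deriv by (rule DERIV_isCont)

text \<open>The moments over a half-line are read off from antiderivatives that vanish at infinity:
  \<open>- \<phi>\<close> for \<open>y \<phi>(y)\<close>, and \<open>- y \<phi>(y)\<close> for \<open>(y\<^sup>2 - 1) \<phi>(y)\<close>. The moments over the lower half-line follow
  by subtraction from those over the whole line.\<close>

lemma gauss_above_FTC: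
  assumes "\<And>y. (F has_real_derivative f y * \<phi> y) (at y)" "\<And>y. isCont f y"
    and "gauss_integrable f" "(F \<longlongrightarrow> 0) at_top"
  shows "gauss_above x f = - F x"
proof -
  have "(LBINT y=ereal x..\<infinity>. f y * \<phi> y) = 0 - F x"
  proof (rule interval_integral_FTC_integrable)
    show "(F has_vector_derivative f y * \<phi> y) (at y)" for y
      using assms(1) by (simp add: has_real_derivative_iff_has_vector_derivative)
    show "isCont (\<lambda>y. f y * \<phi> y) y" for y
      using assms(2) phi_cont by (intro isCont_mult) auto
    show "set_integrable lborel (einterval (ereal x) \<infinity>) (\<lambda>y. f y * \<phi> y)"
      using assms(3) by (rule gauss_integrable_restrict) simp
    have "(F \<longlongrightarrow> F x) (at_right x)"
      using DERIV_isCont[OF assms(1)[of x]] by (simp add: isCont_def filterlim_at_split)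
    then show "((F \<circ> real_of_ereal) \<longlongrightarrow> F x) (at_right (ereal x))"
      by (simp add: ereal_tendsto_simps)
    show "((F \<circ> real_of_ereal) \<longlongrightarrow> 0) (at_left \<infinity>)"
      using assms(4) by (simp add: ereal_tendsto_simps)
  qed simp
  then show ?thesis
    by (simp add: gauss_above_def interval_integral_to_infinity_eq)
qed

lemma gauss_above_id: "gauss_above x (\<lambda>y. y) = \<phi> x"
proof -
  have "((\<lambda>y. - \<phi> y) \<longlongrightarrow> 0) at_top" unfolding phi_eq by real_asymp
  then have "gauss_above x (\<lambda>y. y) = - (- \<phi> x)"
    by (intro gauss_above_FTC) (auto intro!: derivative_eq_intros phi_deriv)
  then show ?thesis by simp
qed

lemma gauss_above_sq: "gauss_above x (\<lambda>y. y\<^sup>2) = x * \<phi> x + gauss_above x (\<lambda>_. 1)"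
proof -
  have "((\<lambda>y. - y * \<phi> y) \<longlongrightarrow> 0) at_top" unfolding phi_eq by real_asymp
  moreover have "((\<lambda>y. - y * \<phi> y) has_real_derivative (y\<^sup>2 - 1) * \<phi> y) (at y)" for y
    by (auto intro!: derivative_eq_intros phi_deriv simp: algebra_simps power2_eq_square)
  ultimately have "gauss_above x (\<lambda>y. y\<^sup>2 - 1) = - (- x * \<phi> x)"
    by (intro gauss_above_FTC) auto
  then show ?thesis by (simp add: gauss_linear)
qed

lemma gauss_below_id: "gauss_below x (\<lambda>y. y) = - \<phi> x"
  using gauss_below_plus_above[of "\<lambda>y. y" x] by (simp add: gauss_above_id gauss_moments)

lemma gauss_below_sq: "gauss_below x (\<lambda>y. y\<^sup>2) = gauss_below x (\<lambda>_. 1) - x * \<phi> x"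
  using gauss_below_plus_above[of "\<lambda>y. y\<^sup>2" x] gauss_below_plus_above[of "\<lambda>_. 1" x]
  by (simp add: gauss_above_sq gauss_moments)

lemma gauss_below_first_moment:
  "gauss_below x (\<lambda>y. x - y) = x * gauss_below x (\<lambda>_. 1) + \<phi> x"
  using gauss_const(1)[of x x] by (simp add: gauss_linear gauss_below_id)

lemma gauss_above_first_moment:
  "gauss_above x (\<lambda>y. y - x) = \<phi> x - x * gauss_above x (\<lambda>_. 1)"
  using gauss_const(2)[of x x] by (simp add: gauss_linear gauss_above_id)

text \<open>Mills' ratio bounds: the left-hand sides are the integrals of \<open>(y - x)\<^sup>2 \<phi>(y)\<close> over the two
  half-lines.\<close>

lemma mills_below: "(1 + x\<^sup>2) * gauss_below x (\<lambda>_. 1) + x * \<phi> x \<ge> 0"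
proof -
  have "gauss_below x (\<lambda>y. 0) \<le> gauss_below x (\<lambda>y. (y\<^sup>2 - 2 * x * y) + x\<^sup>2)"
  proof (rule gauss_mono)
    fix y show "0 \<le> (y\<^sup>2 - 2 * x * y) + x\<^sup>2"
      using zero_le_power2[of "y - x"] by (simp add: power2_diff algebra_simps)
  qed auto
  also have "gauss_below x (\<lambda>y. (y\<^sup>2 - 2 * x * y) + x\<^sup>2) =
      gauss_below x (\<lambda>y. y\<^sup>2) - 2 * x * gauss_below x (\<lambda>y. y) + x\<^sup>2 * gauss_below x (\<lambda>_. 1)"
    by (simp add: gauss_linear gauss_cmult gauss_const(1)[of x "x\<^sup>2"])
  finally show ?thesis
    using gauss_const(1)[of x 0] unfolding gauss_below_id gauss_below_sq
    by (simp add: algebra_simps power2_eq_square)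
qed

lemma mills_above: "(1 + x\<^sup>2) * gauss_above x (\<lambda>_. 1) - x * \<phi> x \<ge> 0"
proof -
  have "gauss_above x (\<lambda>y. 0) \<le> gauss_above x (\<lambda>y. (y\<^sup>2 - 2 * x * y) + x\<^sup>2)"
  proof (rule gauss_mono)
    fix y show "0 \<le> (y\<^sup>2 - 2 * x * y) + x\<^sup>2"
      using zero_le_power2[of "y - x"] by (simp add: power2_diff algebra_simps)
  qed auto
  also have "gauss_above x (\<lambda>y. (y\<^sup>2 - 2 * x * y) + x\<^sup>2) =
      gauss_above x (\<lambda>y. y\<^sup>2) - 2 * x * gauss_above x (\<lambda>y. y) + x\<^sup>2 * gauss_above x (\<lambda>_. 1)"
    by (simp add: gauss_linear gauss_cmult gauss_const(2)[of x "x\<^sup>2"])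
  finally show ?thesis
    using gauss_const(2)[of x 0] unfolding gauss_above_id gauss_above_sq
    by (simp add: algebra_simps power2_eq_square)
qed

lemma gauss_below_deriv:
  assumes "\<And>y. isCont g y" "gauss_integrable g"
  shows "((\<lambda>x. gauss_below x g) has_real_derivative g x * \<phi> x) (at x)"
proof -
  let ?g = "\<lambda>y. g y * \<phi> y"
  let ?G = "\<lambda>u. LBINT y=ereal x..ereal u. ?g y"
  have cont: "continuous_on S ?g" for S
    using assms(1) phi_cont by (intro continuous_at_imp_continuous_on ballI isCont_mult) auto
  have split: "gauss_below u g = gauss_below x g + ?G u" for u
  proof -
    \<comment> \<open>Interval integrals are taken over open intervals; the end point is a null set.\<close>
    have below: "gauss_below v g = (LBINT y=-\<infinity>..ereal v. ?g y)" for v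
    proof -
      have "gauss_below v g = (LINT y:{..<v}|lborel. ?g y)"
        unfolding gauss_below_def set_lebesgue_integral_def
      proof (rule integral_cong_AE)
        show "AE y in lborel. indicat_real {..v} y *\<^sub>R (g y * \<phi> y) =
            indicat_real {..<v} y *\<^sub>R (g y * \<phi> y)"
          using AE_lborel_singleton[of v] by eventually_elim (auto simp: indicator_def)
      qed (use cont[of UNIV, THEN borel_measurable_continuous_onI] in auto)
      then show ?thesis by (simp add: interval_lebesgue_integral_def)
    qed
    have "set_integrable lborel (einterval a b) ?g" for a b
      using assms(2) by (rule gauss_integrable_restrict) simp
    then have "interval_lebesgue_integrable lborel a b ?g" for a b
      by (simp add: interval_lebesgue_integrable_def)
    from interval_integral_sum[OF this] show ?thesis
      unfolding below by simp
  qed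
  have "(?G has_vector_derivative ?g x) (at x within {x - 1..x + 1})"
    by (rule interval_integral_FTC2) (auto intro: cont)
  then have "(?G has_vector_derivative ?g x) (at x)"
    by (subst (asm) at_within_interior) (auto simp: interior_atLeastAtMost_real)
  then have "(?G has_real_derivative ?g x) (at x)"
    by (simp add: has_real_derivative_iff_has_vector_derivative)
  then have "((\<lambda>u. gauss_below x g + ?G u) has_real_derivative ?g x) (at x)"
    by (auto intro!: derivative_eq_intros)
  moreover have "(\<lambda>u. gauss_below u g) = (\<lambda>u. gauss_below x g + ?G u)"
    using split by (rule ext)
  ultimately show ?thesis by (simp only:)
qed


section \<open>Stein's equation for the standard normal law\<close>

text \<open>For Lipschitz \<open>h\<close>, the unique bounded solution of \<open>f'(x) - x f(x) = h(x) - E h(Z)\<close>, obtained with the integrating factor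
  \<open>\<phi>\<close>; its derivative is \<open>stein_slope h\<close>.\<close>

definition stein_solution :: "(real \<Rightarrow> real) \<Rightarrow> real \<Rightarrow> real" where
  "stein_solution h x = gauss_below x (\<lambda>y. h y - gauss_mean h) / \<phi> x"

definition stein_slope :: "(real \<Rightarrow> real) \<Rightarrow> real \<Rightarrow> real" where
  "stein_slope h x = x * stein_solution h x + (h x - gauss_mean h)"

lemma stein_solution_deriv:
  assumes "\<And>y. isCont h y" "gauss_integrable h"
  shows "(stein_solution h has_real_derivative stein_slope h x) (at x)"
proof -
  let ?g = "\<lambda>y. h y - gauss_mean h"
  have g: "((\<lambda>x. gauss_below x ?g) has_real_derivative ?g x * \<phi> x) (at x)"
    using assms by (intro gauss_below_deriv) auto
  have "((\<lambda>x. gauss_below x ?g / \<phi> x) has_real_derivative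
      (?g x * \<phi> x * \<phi> x - gauss_below x ?g * (- x * \<phi> x)) / (\<phi> x * \<phi> x)) (at x)"
    using phi_pos[of x] by (intro DERIV_divide g phi_deriv) simp
  moreover have "(?g x * \<phi> x * \<phi> x - gauss_below x ?g * (- x * \<phi> x)) / (\<phi> x * \<phi> x)
      = stein_slope h x"
    using phi_pos[of x] by (simp add: stein_slope_def stein_solution_def field_simps)
  ultimately show ?thesis by (simp add: stein_solution_def[abs_def])
qed

text \<open>The second bound is the heart of the proof: it says that \<open>x f(x)\<close> is 1-Lipschitz. Both quantities,
  multiplied by \<open>\<phi>(x)\<close>, are combinations of the integrals \<open>A\<close> and \<open>B\<close> of \<open>(h(y) - h(x)) \<phi>(y)\<close> over the two
  half-lines with coefficients of known sign, and for a 1-Lipschitz \<open>h\<close> these integrals are at most the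
  first absolute moments about \<open>x\<close>.\<close>

lemma stein_solution_bounds:
  assumes h: "1-lipschitz_on UNIV h"
  shows "\<bar>stein_solution h x\<bar> \<le> 1"
    and "\<bar>stein_solution h x + x * stein_slope h x\<bar> \<le> 1"
proof -
  define k where "k y = h y - h x" for y
  define A B n p q where "A = gauss_below x k" and "B = gauss_above x k"
    and "n = gauss_below x (\<lambda>_. 1)" and "p = gauss_above x (\<lambda>_. 1)" and "q = \<phi> x"
  have int_h: "gauss_integrable h" using h by (rule gauss_integrable_lipschitz)
  then have int_k: "gauss_integrable k" unfolding k_def by simp
  have q: "q > 0" unfolding q_def by (rule phi_pos)
  have np: "n + p = 1"
    using gauss_below_plus_above[of "\<lambda>_. 1" x] by (simp add: n_def p_def gauss_moments)
  have n0: "n \<ge> 0" and p0: "p \<ge> 0"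
    unfolding n_def p_def gauss_below_def gauss_above_def set_lebesgue_integral_def
    by (auto intro!: Bochner_Integration.integral_nonneg)
  \<comment> \<open>One-sided forms, so that monotonicity of the half-line integrals applies to \<open>k\<close> and to \<open>- k\<close>.\<close>
  have k_le: "k y \<le> \<bar>y - x\<bar>" "- k y \<le> \<bar>y - x\<bar>" for y
    using lipschitz_onD[OF h, of y x] by (auto simp: k_def dist_real_def abs_le_iff)
  have int_mk: "gauss_integrable (\<lambda>y. (-1) * k y)"
    using int_k by (rule gauss_integrable_intros(6))
  have A: "\<bar>A\<bar> \<le> x * n + q"
  proof -
    have "gauss_below x k \<le> gauss_below x (\<lambda>y. x - y)"
    proof (rule gauss_mono)
      show "k y \<le> x - y" if "y \<le> x" for y using k_le(1)[of y] that by simp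
    qed (use int_k in auto)
    moreover have "gauss_below x (\<lambda>y. (-1) * k y) \<le> gauss_below x (\<lambda>y. x - y)"
    proof (rule gauss_mono)
      show "(-1) * k y \<le> x - y" if "y \<le> x" for y using k_le(2)[of y] that by simp
    qed (use int_mk in auto)
    ultimately show ?thesis
      unfolding gauss_cmult gauss_below_first_moment A_def B_def n_def p_def q_def by linarith
  qed
  have B: "\<bar>B\<bar> \<le> q - x * p"
  proof -
    have "gauss_above x k \<le> gauss_above x (\<lambda>y. y - x)"
    proof (rule gauss_mono)
      show "k y \<le> y - x" if "y > x" for y using k_le(1)[of y] that by simp
    qed (use int_k in auto)
    moreover have "gauss_above x (\<lambda>y. (-1) * k y) \<le> gauss_above x (\<lambda>y. y - x)"
    proof (rule gauss_mono)
      show "(-1) * k y \<le> y - x" if "y > x" for y using k_le(2)[of y] that by simp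
    qed (use int_mk in auto)
    ultimately show ?thesis
      unfolding gauss_cmult gauss_above_first_moment A_def B_def n_def p_def q_def by linarith
  qed
  have below_h: "gauss_below x h = A + h x * n"
    using gauss_linear(2)[of h "\<lambda>_. h x" x] int_h gauss_const(1)[of x "h x"]
    by (simp add: A_def k_def[abs_def] n_def)
  have above_h: "gauss_above x h = B + h x * p"
    using gauss_linear(4)[of h "\<lambda>_. h x" x] int_h gauss_const(2)[of x "h x"]
    by (simp add: B_def k_def[abs_def] p_def)
  have mean: "gauss_mean h = A + B + h x"
  proof -
    have "gauss_mean h = A + B + h x * (n + p)"
      using gauss_below_plus_above[OF int_h, of x] by (simp add: below_h above_h algebra_simps)
    then show ?thesis by (simp add: np)
  qed
  have sol: "stein_solution h x * q = p * A - n * B"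
  proof -
    have "stein_solution h x * q = gauss_below x h - gauss_mean h * n"
      using q gauss_linear(2)[of h "\<lambda>_. gauss_mean h" x] int_h gauss_const(1)[of x "gauss_mean h"]
      by (simp add: stein_solution_def q_def n_def)
    also have "\<dots> = (1 - n) * A - n * B"
      by (simp add: below_h mean algebra_simps)
    also have "1 - n = p" using np by simp
    finally show ?thesis .
  qed
  have "\<bar>stein_solution h x\<bar> * q = \<bar>p * A - n * B\<bar>"
    using q by (simp flip: sol add: abs_mult)
  also have "\<dots> \<le> p * \<bar>A\<bar> + n * \<bar>B\<bar>"
    using n0 p0 abs_triangle_ineq4[of "p * A" "n * B"] by (simp add: abs_mult)
  also have "\<dots> \<le> p * (x * n + q) + n * (q - x * p)"
    using A B n0 p0 by (intro add_mono mult_left_mono) auto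
  also have "\<dots> = (n + p) * q" by (simp add: algebra_simps)
  finally show "\<bar>stein_solution h x\<bar> \<le> 1"
    using q np by simp
  \<comment> \<open>The nonnegative Mills coefficients of \<open>A\<close> and \<open>- B\<close>.\<close>
  define P N where "P = (1 + x\<^sup>2) * p - x * q" and "N = (1 + x\<^sup>2) * n + x * q"
  have P: "P \<ge> 0" and N: "N \<ge> 0"
    using mills_above[of x] mills_below[of x] by (auto simp: P_def N_def p_def n_def q_def)
  have "(stein_solution h x + x * stein_slope h x) * q
      = (1 + x\<^sup>2) * (stein_solution h x * q) - x * q * (A + B)"
    by (simp add: stein_slope_def mean algebra_simps power2_eq_square)
  also have "\<dots> = P * A - N * B"
    unfolding sol by (simp add: P_def N_def algebra_simps)
  finally have "\<bar>stein_solution h x + x * stein_slope h x\<bar> * q = \<bar>P * A - N * B\<bar>"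
    using q by (metis abs_mult abs_of_pos)
  also have "\<dots> \<le> P * \<bar>A\<bar> + N * \<bar>B\<bar>"
    using P N abs_triangle_ineq4[of "P * A" "N * B"] by (simp add: abs_mult)
  also have "\<dots> \<le> P * (x * n + q) + N * (q - x * p)"
    using A B P N by (intro add_mono mult_left_mono) auto
  also have "\<dots> = q * ((1 + x\<^sup>2) * (n + p) - x\<^sup>2 * (n + p))"
    by (simp add: P_def N_def algebra_simps power2_eq_square)
  finally show "\<bar>stein_solution h x + x * stein_slope h x\<bar> \<le> 1"
    using q np by simp
qed

text \<open>One unit of the Lipschitz constant comes from \<open>x f(x)\<close>, the other from \<open>h\<close> itself.\<close>

lemma stein_slope_lipschitz:
  assumes h: "1-lipschitz_on UNIV h"
  shows "2-lipschitz_on UNIV (stein_slope h)"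
proof -
  have cont: "isCont h y" for y
    using lipschitz_on_continuous_on[OF h] by (simp add: continuous_on_eq_continuous_at)
  have "((\<lambda>x. x * stein_solution h x) has_real_derivative
      stein_solution h x + x * stein_slope h x) (at x within UNIV)" for x
    by (auto intro!: derivative_eq_intros stein_solution_deriv cont gauss_integrable_lipschitz h)
  then have "norm (y * stein_solution h y - x * stein_solution h x) \<le> 1 * norm (y - x)" for x y
    by (rule field_differentiable_bound[OF convex_UNIV])
       (auto simp: stein_solution_bounds[OF h])
  then have "1-lipschitz_on UNIV (\<lambda>x. x * stein_solution h x)"
    by (intro lipschitz_onI) (auto simp: dist_norm)
  from lipschitz_on_add[OF this lipschitz_on_diff[OF h lipschitz_on_constant]]
  show ?thesis
    by (simp add: stein_slope_def[abs_def])
qed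

text \<open>Boundedness ensures that \<open>f'(W')\<close> is integrable although \<open>W'\<close> need not be. For \<open>\<bar>x\<bar> \<ge> 1\<close> the bounds on
  \<open>f\<close> and \<open>f + x f'\<close> give \<open>\<bar>f'(x)\<bar> \<le> 2\<close>; any other point has distance at most 2 from \<open>1\<close>, which costs at most
  \<open>2 \<cdot> 2\<close> more by the Lipschitz property.\<close>

lemma stein_slope_bounded:
  assumes h: "1-lipschitz_on UNIV h"
  shows "\<bar>stein_slope h x\<bar> \<le> 6"
proof -
  have far: "\<bar>stein_slope h y\<bar> \<le> 2" if "\<bar>y\<bar> \<ge> 1" for y
  proof -
    have "\<bar>stein_slope h y\<bar> \<le> \<bar>y\<bar> * \<bar>stein_slope h y\<bar>"
      using that by (simp add: mult_le_cancel_right1)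
    also have "\<dots> \<le> 2"
      using stein_solution_bounds[OF h, of y] by (simp flip: abs_mult)
    finally show ?thesis .
  qed
  show ?thesis
  proof (cases "\<bar>x\<bar> \<ge> 1")
    case False
    then show ?thesis
      using lipschitz_onD[OF stein_slope_lipschitz[OF h], of x 1] far[of 1]
      by (auto simp: dist_real_def)
  qed (use far[of x] in auto)
qed

section \<open>Stein's equation for a centred normal law\<close>

text \<open>Scaling: if \<open>g\<close> is the standard solution for \<open>H(y) = h(s y) / s\<close>, which is again 1-Lipschitz, then
  \<open>f(x) = g(x / s)\<close> solves the equation with variance \<open>s\<^sup>2\<close>, and the Lipschitz constant of the derivative is
  divided by \<open>s\<^sup>2\<close>.\<close>

lemma normal_stein_equation:
  assumes "s > 0" and h: "1-lipschitz_on UNIV h"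
  obtains f f' where
    "\<And>x. (f has_real_derivative f' x) (at x)"
    "\<And>x. s\<^sup>2 * f' x - x * f x = h x - (\<integral>y. h y * normal_density 0 s y \<partial>lborel)"
    "\<And>x. \<bar>f x\<bar> \<le> 1" "\<And>x. \<bar>f' x\<bar> \<le> 6 / s" "(2 / s\<^sup>2)-lipschitz_on UNIV f'"
proof -
  define H where "H y = h (s * y) / s" for y
  have H: "1-lipschitz_on UNIV H"
  proof (rule lipschitz_onI)
    fix x y :: real
    have "\<bar>h (s * x) - h (s * y)\<bar> \<le> \<bar>s * (x - y)\<bar>"
      using lipschitz_onD[OF h, of "s * x" "s * y"] by (simp add: dist_real_def right_diff_distrib)
    then have "\<bar>h (s * x) - h (s * y)\<bar> / s \<le> \<bar>x - y\<bar>"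
      using \<open>s > 0\<close> by (simp add: abs_mult pos_divide_le_eq mult.commute)
    then show "dist (H x) (H y) \<le> 1 * dist x y"
      using \<open>s > 0\<close> by (simp add: H_def dist_real_def flip: diff_divide_distrib)
  qed simp
  have contH: "isCont H y" for y
    using lipschitz_on_continuous_on[OF H] by (simp add: continuous_on_eq_continuous_at)
  have mean: "s * gauss_mean H = (\<integral>y. h y * normal_density 0 s y \<partial>lborel)"
  proof -
    have "(\<integral>y. h y * normal_density 0 s y \<partial>lborel)
        = \<bar>s\<bar> *\<^sub>R (\<integral>y. h (0 + s * y) * normal_density 0 s (0 + s * y) \<partial>lborel)"
      using \<open>s > 0\<close> by (intro lborel_integral_real_affine) simp
    also have "\<dots> = (\<integral>y. s * (h (s * y) * normal_density 0 s (s * y)) \<partial>lborel)"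
      using \<open>s > 0\<close> by simp
    also have "\<dots> = (\<integral>y. s * (H y * \<phi> y) \<partial>lborel)"
    proof (rule Bochner_Integration.integral_cong)
      fix y
      have "s * normal_density 0 s (s * y) = \<phi> y"
        using \<open>s > 0\<close> by (simp add: normal_density_def real_sqrt_mult power_mult_distrib)
      then show "s * (h (s * y) * normal_density 0 s (s * y)) = s * (H y * \<phi> y)"
        using \<open>s > 0\<close> by (simp add: H_def algebra_simps)
    qed simp
    finally show ?thesis by (simp add: gauss_mean_def)
  qed
  let ?f = "\<lambda>x. stein_solution H (x / s)" and ?f' = "\<lambda>x. stein_slope H (x / s) / s"
  show thesis
  proof (rule that[of ?f ?f'])
    show "(?f has_real_derivative ?f' x) (at x)" for x
    proof -
      have "((\<lambda>x. x / s) has_real_derivative 1 / s) (at x)"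
        using \<open>s > 0\<close> by (auto intro!: derivative_eq_intros)
      from DERIV_chain2[OF stein_solution_deriv[OF contH gauss_integrable_lipschitz[OF H]] this]
      show ?thesis by simp
    qed
    show "s\<^sup>2 * ?f' x - x * ?f x = h x - (\<integral>y. h y * normal_density 0 s y \<partial>lborel)" for x
      using \<open>s > 0\<close> unfolding mean[symmetric]
      by (simp add: stein_slope_def H_def field_simps power2_eq_square)
    show "\<bar>?f x\<bar> \<le> 1" for x
      by (rule stein_solution_bounds(1)[OF H])
    show "\<bar>?f' x\<bar> \<le> 6 / s" for x
      using stein_slope_bounded[OF H, of "x / s"] \<open>s > 0\<close> by (simp add: abs_divide divide_right_mono)
    show "(2 / s\<^sup>2)-lipschitz_on UNIV ?f'"
    proof (rule lipschitz_onI)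
      fix x y :: real
      have "dist (?f' x) (?f' y) = \<bar>stein_slope H (x / s) - stein_slope H (y / s)\<bar> / s"
        using \<open>s > 0\<close> by (simp add: dist_real_def flip: diff_divide_distrib)
      also have "\<dots> \<le> 2 * \<bar>x / s - y / s\<bar> / s"
        using lipschitz_onD[OF stein_slope_lipschitz[OF H], of "x / s" "y / s"] \<open>s > 0\<close>
        by (intro divide_right_mono) (auto simp: dist_real_def)
      also have "\<dots> = 2 / s\<^sup>2 * dist x y"
        using \<open>s > 0\<close> by (simp add: dist_real_def power2_eq_square flip: diff_divide_distrib)
      finally show "dist (?f' x) (?f' y) \<le> 2 / s\<^sup>2 * dist x y" .
    qed simp
  qed
qed

section \<open>Comparison of the Wasserstein distances\<close>

lemma wasserstein_dist_ge:
  assumes "1-lipschitz_on UNIV h" "integrable M (\<lambda>x. h (Y x))" "integrable N (\<lambda>x. h (X x))"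
  shows "ennreal \<bar>(\<integral>x. h (Y x) \<partial>M) - (\<integral>x. h (X x) \<partial>N)\<bar> \<le> wasserstein_dist M Y N X"
  unfolding wasserstein_dist_def using assms by (intro SUP_upper) auto

theorem lemma2p1:
  fixes M :: "'a measure" and W :: "'a \<Rightarrow> real"
    and M' :: "'b measure" and W' :: "'b \<Rightarrow> real"
    and K :: "'c measure" and Z :: "'c \<Rightarrow> real"
  assumes "prob_space M" and "W \<in> borel_measurable M"
    and "integrable M (\<lambda>x. (W x)\<^sup>2)" and "prob_space.expectation M W = 0"
    and "prob_space M'" and "W' \<in> borel_measurable M'"
    and "zero_bias M W M' W'"
    and "prob_space K" and "Z \<in> borel_measurable K"
    and "distr K borel Z = normal_law 0 (prob_space.variance M W)"
  shows "wasserstein_dist M W K Z \<le> 2 * wasserstein_dist M W M' W'"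
proof -
  interpret M: prob_space M by fact
  interpret M': prob_space M' by fact
  note [measurable] = \<open>W \<in> borel_measurable M\<close> \<open>W' \<in> borel_measurable M'\<close>
    \<open>Z \<in> borel_measurable K\<close>
  define v where "v = M.variance W"
  have v_eq: "v = (\<integral>x. (W x)\<^sup>2 \<partial>M)" using assms(4) by (simp add: v_def)
  then have "v \<ge> 0" by simp
  have intW: "integrable M W"
    by (rule M.square_integrable_imp_integrable) (use assms(3) in auto)
  have "ennreal \<bar>(\<integral>x. h (W x) \<partial>M) - (\<integral>x. h (Z x) \<partial>K)\<bar> \<le> 2 * wasserstein_dist M W M' W'"
    if h: "1-lipschitz_on UNIV h" for h
  proof -
    have h_borel [measurable]: "h \<in> borel_measurable borel"
      using lipschitz_on_continuous_on[OF h] by (rule borel_measurable_continuous_onI)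
    have Z_mean: "(\<integral>x. h (Z x) \<partial>K) = (\<integral>y. h y \<partial>normal_law 0 v)"
      unfolding v_def assms(10)[symmetric] by (subst integral_distr) auto
    show ?thesis
    proof (cases "v = 0")
      case True
      have "AE x in M. (W x)\<^sup>2 = 0"
        using integral_nonneg_eq_0_iff_AE[OF assms(3)] True v_eq by simp
      then have "(\<integral>x. h (W x) \<partial>M) = (\<integral>x. h 0 \<partial>M)"
        by (intro integral_cong_AE) auto
      also have "\<dots> = (\<integral>x. h (Z x) \<partial>K)"
        unfolding Z_mean using True by (simp add: normal_law_def integral_return M.prob_space)
      finally show ?thesis by simp
    next
      case False
      define s where "s = sqrt v"
      have "s > 0" and s2: "s\<^sup>2 = v" using False \<open>v \<ge> 0\<close> by (auto simp: s_def)
      obtain f f' where deriv: "\<And>x. (f has_real_derivative f' x) (at x)"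
        and stein: "\<And>x. s\<^sup>2 * f' x - x * f x = h x - (\<integral>y. h y * normal_density 0 s y \<partial>lborel)"
        and f: "\<And>x. \<bar>f x\<bar> \<le> 1" and f': "\<And>x. \<bar>f' x\<bar> \<le> 6 / s"
        and lip: "(2 / s\<^sup>2)-lipschitz_on UNIV f'"
        by (rule normal_stein_equation[OF \<open>s > 0\<close> h]) (rule that)
      have [measurable]: "f' \<in> borel_measurable borel"
        using lipschitz_on_continuous_on[OF lip] by (rule borel_measurable_continuous_onI)
      have [measurable]: "f \<in> borel_measurable borel"
        using deriv by (intro borel_measurable_continuous_onI continuous_at_imp_continuous_on)
          (auto intro: DERIV_isCont)
      have intf'W: "integrable M (\<lambda>x. f' (W x))"
        by (rule M.integrable_const_bound[of _ "6 / s"]) (use f' in auto)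
      have intf'W': "integrable M' (\<lambda>x. f' (W' x))"
        by (rule M'.integrable_const_bound[of _ "6 / s"]) (use f' in auto)
      have intWf: "integrable M (\<lambda>x. W x * f (W x))"
        by (rule Bochner_Integration.integrable_bound[OF intW])
           (auto simp: abs_mult intro!: mult_left_le f)
      have "norm (f y - f x) \<le> 6 / s * norm (y - x)" for x y
        by (rule field_differentiable_bound[OF convex_UNIV, of f f'])
           (use deriv f' in \<open>auto intro: has_field_derivative_at_within\<close>)
      then have "(6 / s)-lipschitz_on UNIV f"
        using \<open>s > 0\<close> by (intro lipschitz_onI) (auto simp: dist_norm)
      then have "absolutely_continuous_fun f"
        by (rule lipschitz_on_imp_absolutely_continuous_fun)
      moreover have "deriv f = f'" using deriv by (auto simp: fun_eq_iff intro: DERIV_imp_deriv)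
      ultimately have zb: "(\<integral>x. W x * f (W x) \<partial>M) = v * (\<integral>y. f' (W' y) \<partial>M')"
        using assms(7) intWf intf'W' unfolding zero_bias_def v_def by auto
      have Zn: "(\<integral>x. h (Z x) \<partial>K) = (\<integral>y. h y * normal_density 0 s y \<partial>lborel)"
        unfolding Z_mean normal_law_def using False
        by (simp add: s_def integral_density mult.commute)
      \<comment> \<open>The normalisation that makes the derivative of the Stein solution 1-Lipschitz.\<close>
      let ?g = "\<lambda>x. v / 2 * f' x"
      have "(\<integral>x. h (W x) \<partial>M) - (\<integral>x. h (Z x) \<partial>K)
          = (\<integral>x. h (W x) - (\<integral>x. h (Z x) \<partial>K) \<partial>M)"
        using lipschitz_on_integrable_comp[OF M.finite_measure_axioms intW h]
        by (simp add: M.prob_space)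
      also have "\<dots> = (\<integral>x. v * f' (W x) - W x * f (W x) \<partial>M)"
        using stein by (simp add: Zn s2)
      also have "\<dots> = 2 * ((\<integral>x. ?g (W x) \<partial>M) - (\<integral>x. ?g (W' x) \<partial>M'))"
        using intf'W intWf by (simp add: zb)
      finally have "ennreal \<bar>(\<integral>x. h (W x) \<partial>M) - (\<integral>x. h (Z x) \<partial>K)\<bar>
          = 2 * ennreal \<bar>(\<integral>x. ?g (W x) \<partial>M) - (\<integral>x. ?g (W' x) \<partial>M')\<bar>"
        by (simp only: abs_mult ennreal_mult abs_numeral ennreal_numeral abs_ge_zero zero_le_numeral)
      also have "\<dots> \<le> 2 * wasserstein_dist M W M' W'"
      proof (intro mult_left_mono wasserstein_dist_ge)
        show "1-lipschitz_on UNIV ?g"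
          using lipschitz_on_cmult_real[OF lip, of "v / 2"] False \<open>v \<ge> 0\<close>
          by (simp add: s2)
      qed (use intf'W intf'W' in auto)
      finally show ?thesis .
    qed
  qed
  then show ?thesis
    unfolding wasserstein_dist_def[of M W K Z] by (intro SUP_least) auto
qed

end
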